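(* There exists a field $K$ that is rootless but not rootless modtor.
   Context: Let $F$ be a field. An element $a \in F$ that is not a root of unity is rootless (in $F$) if for all but finitely many integers $n\ge 1$ the equation $x^n = a$ has no solution in $F$. An element $a\in F$ that is not a root of unity is rootless modtor (in $F$) if for all but finitely many integers $n\ge 1$, for every root of unity $\zeta \in F$ the equation $x^n=\zeta a$ has no solution in $F$. The field $F$ is rootless (resp. rootless modtor) if every nonzero $f \in F$ that is not a root of unity is rootless (resp. rootless modtor) in $F$. *)

theory Defs
  imports "HOL-Algebra.Ring" Complex_Main
begin

definition is_root_of_unity :: "('a, 'b) ring_scheme \<Rightarrow> 'a \<Rightarrow> bool" where
  "is_root_of_unity F a \<longleftrightarrow>
     a \<in> carrier F \<and> (\<exists>n::nat. n \<ge> 1 \<and> a [^]\<^bsub>F\<^esub> n = \<one>\<^bsub>F\<^esub>)"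

definition rootless_elem :: "('a, 'b) ring_scheme \<Rightarrow> 'a \<Rightarrow> bool" where
  "rootless_elem F a \<longleftrightarrow>
     a \<in> carrier F \<and> \<not> is_root_of_unity F a \<and>
     finite {n::nat. n \<ge> 1 \<and> (\<exists>x \<in> carrier F. x [^]\<^bsub>F\<^esub> n = a)}"

text \<open>The exceptional set of exponents is uniform in the root of unity: an exponent is
  exceptional as soon as the equation is solvable for some root of unity.\<close>

definition rootless_modtor_elem :: "('a, 'b) ring_scheme \<Rightarrow> 'a \<Rightarrow> bool" where
  "rootless_modtor_elem F a \<longleftrightarrow>
     a \<in> carrier F \<and> \<not> is_root_of_unity F a \<and>
     finite {n::nat. n \<ge> 1 \<and>
       \<not> (\<forall>\<zeta>. is_root_of_unity F \<zeta> \<longrightarrow>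
            \<not> (\<exists>x \<in> carrier F. x [^]\<^bsub>F\<^esub> n = \<zeta> \<otimes>\<^bsub>F\<^esub> a))}"

definition rootless :: "('a, 'b) ring_scheme \<Rightarrow> bool" where
  "rootless F \<longleftrightarrow>
     (\<forall>f \<in> carrier F. f \<noteq> \<zero>\<^bsub>F\<^esub> \<and> \<not> is_root_of_unity F f \<longrightarrow> rootless_elem F f)"

definition rootless_modtor :: "('a, 'b) ring_scheme \<Rightarrow> bool" where
  "rootless_modtor F \<longleftrightarrow>
     (\<forall>f \<in> carrier F. f \<noteq> \<zero>\<^bsub>F\<^esub> \<and> \<not> is_root_of_unity F f \<longrightarrow> rootless_modtor_elem F f)"

end

theory Submission
  imports Defs "HOL-Algebra.Algebraic_Closure_Type" "HOL-Library.Countable_Set"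
begin

text \<open>
  The obstruction to being rootless modtor has to come from the torsion: what is needed is an
  element that becomes an n-th power after multiplication by a suitable root of unity, for
  infinitely many n, while that root of unity cannot be dispensed with.

  Let k be the quadratic closure of F_2, the union of the fields with q_j = 2^(2^j) elements.
  All its nonzero elements are roots of unity, and q_(j+1) - 1 is the product of q_j - 1 and the
  Fermat number F_j = 2^(2^j) + 1, where the F_j are pairwise coprime. For a prime l_j dividing
  F_j the l_j-primary part of the multiplicative group of k is therefore finite and nontrivial, so
  some \<zeta>_j of l_j-power order is not an l_j-th power in k (torsion_field_exists).

  Choose s_0 transcendental over k and s_1, s_2, ... with s_j = \<zeta>_j s_(j+1)^(l_j) in an algebraic
  closure, and let K be the union of the fields k(s_j) (radical_tower_exists). For every d, s_0 is
  a root of unity times the power of s_d with exponent l_0 ... l_(d-1); hence s_0 is not rootless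
  modtor (tower_field_infinite_twisted_roots).

  That K is rootless is shown by valuations (tower_field_finite_roots). Let f = P(s_J) / Q(s_J) be
  an n-th power in k(s_I) with I \<ge> J. Since s_J is a constant times s_I^M, where
  M = l_J ... l_(I-1), passing from level J to level I means substituting a monomial c X^M into
  P and Q. If P and Q vanish to different orders at some \<alpha> \<noteq> 0, the difference of these orders
  does not change under this substitution, because M is prime to the characteristic; it is
  divisible by n, which bounds n. If the degrees of P and Q differ by a > 0, one only gets that n
  divides a M. But leading coefficients are multiplicative as well, and comparing them shows that
  a prime l_j with J \<le> j < I that divides n, but neither a nor the order of the leading coefficient of f,
  would make \<zeta>_j an l_j-th power in k. As the l_j are distinct, n divides a number
  independent of I. If neither case applies, f is constant, hence a root of unity.

  The field K is countable, so its structure can be transported to a set of complex numbers.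
\<close>

hide_const (open) Coset.order


section \<open>Orders and substitution of monomials\<close>

text \<open>The polynomial c X^m - \<alpha> is separable when \<alpha> \<noteq> 0 and m is invertible: substituting c X^m is
unramified away from 0 and infinity, and so preserves multiplicities there.\<close>

lemma order_pcompose_monom:
  fixes P :: "'a::field poly"
  assumes "c * \<beta> ^ m = \<alpha>" "\<alpha> \<noteq> 0" "of_nat m \<noteq> (0::'a)" "P \<noteq> 0"
  shows "order \<beta> (pcompose P (monom c m)) = order \<alpha> P"
proof -
  obtain R where R: "P = [:-\<alpha>, 1:] ^ order \<alpha> P * R" "\<not> [:-\<alpha>, 1:] dvd R"
    using order_decomp[OF assms(4)] by blast
  have m: "m > 0" using assms(3) by (cases m) auto
  have c: "c \<noteq> 0" and b: "\<beta> \<noteq> 0" using assms(1,2) m by auto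
  define U where "U = monom c m - [:\<alpha>:]"
  have U: "pcompose [:-\<alpha>, 1:] (monom c m) = U"
    by (simp add: pcompose_pCons U_def one_pCons)
  have deg: "degree (monom c m) > 0" using c m by (simp add: degree_monom_eq)
  have U0: "U \<noteq> 0"
    using deg unfolding U_def by (metis degree_pCons_0 eq_iff_diff_eq_0 less_irrefl)
  have "poly (pderiv U) \<beta> \<noteq> 0"
    using c b assms(3) by (simp add: U_def pderiv_diff pderiv_monom pderiv_pCons poly_monom)
  moreover have root: "poly U \<beta> = 0" using assms(1) by (simp add: U_def poly_monom)
  ultimately have ordU: "order \<beta> U = 1"
  proof -
    obtain V where V: "U = [:-\<beta>, 1:] * V"
      using root poly_eq_0_iff_dvd by blast
    have "poly (pderiv U) \<beta> = poly V \<beta>"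
      by (simp add: V pderiv_mult pderiv_pCons del: mult_pCons_left)
    with \<open>poly (pderiv U) \<beta> \<noteq> 0\<close> have "poly V \<beta> \<noteq> 0" by simp
    then show ?thesis
      using U0 unfolding V by (subst order_mult) (auto simp: order_0I order_power_n_n[of \<beta> 1, simplified])
  qed
  have R0: "R \<noteq> 0" using R(2) by auto
  have "poly (pcompose R (monom c m)) \<beta> \<noteq> 0"
    using R(2) assms(1) by (simp add: poly_pcompose poly_monom poly_eq_0_iff_dvd)
  then have ordR: "order \<beta> (pcompose R (monom c m)) = 0" and
    nz: "pcompose R (monom c m) \<noteq> 0" by (auto simp: order_0I)
  have pw: "pcompose ([:-\<alpha>, 1:] ^ n) (monom c m) = U ^ n" for n
    by (induction n) (simp_all add: pcompose_1 pcompose_mult U del: mult_pCons_left)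
  have ordp: "order \<beta> (U ^ n) = n" for n
    using U0 ordU by (induction n) (auto simp: order_mult)
  have "pcompose P (monom c m) = U ^ order \<alpha> P * pcompose R (monom c m)"
    by (subst R(1)) (simp add: pcompose_mult pw)
  then show ?thesis
    using U0 nz ordR by (simp add: order_mult ordp)
qed

lemma no_nonzero_root_imp_monom:
  fixes P :: "'a::alg_closed_field poly"
  assumes "P \<noteq> 0" "\<And>x. x \<noteq> 0 \<Longrightarrow> poly P x \<noteq> 0"
  shows "P = monom (lead_coeff P) (degree P)"
proof -
  obtain R where R: "P = [:-0, 1:] ^ order 0 P * R" "\<not> [:-0, 1:] dvd R"
    using order_decomp[OF assms(1)] by blast
  have R0: "R \<noteq> 0" using R assms by auto
  have "poly R x \<noteq> 0" for x
  proof (cases "x = 0")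
    case True
    then show ?thesis using R(2) by (simp add: poly_eq_0_iff_dvd)
  next
    case False
    then show ?thesis using assms(2)[of x] by (subst (asm) R(1)) auto
  qed
  then have "degree R = 0" using alg_closed_imp_poly_has_root by blast
  then obtain d where d: "R = [:d:]" by (auto elim: degree_eq_zeroE)
  have "P = monom d (order 0 P)"
    by (subst R(1)) (simp add: d monom_altdef)
  moreover have "d \<noteq> 0" using R0 d by auto
  ultimately show ?thesis by (metis degree_monom_eq lead_coeff_monom)
qed

text \<open>Dividing out the common nonzero roots leaves two monomials of the same degree.\<close>

lemma proportional_if_same_nonzero_roots:
  fixes P Q :: "'a::alg_closed_field poly"
  assumes "P \<noteq> 0" "Q \<noteq> 0" "degree P = degree Q"
    "\<And>x. x \<noteq> 0 \<Longrightarrow> order x P = order x Q"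
  shows "smult (lead_coeff Q) P = smult (lead_coeff P) Q"
  using assms
proof (induction "degree P" arbitrary: P Q rule: less_induct)
  case less
  show ?case
  proof (cases "\<exists>x. x \<noteq> 0 \<and> poly P x = 0")
    case False
    then have "P = monom (lead_coeff P) (degree P)"
      using less.prems no_nonzero_root_imp_monom by blast
    moreover have "\<And>x. x \<noteq> 0 \<Longrightarrow> poly Q x \<noteq> 0"
      using False less.prems by (metis order_root)
    then have "Q = monom (lead_coeff Q) (degree Q)"
      using less.prems no_nonzero_root_imp_monom by blast
    ultimately show ?thesis
      using less.prems(3) by (metis mult.commute smult_monom)
  next
    case True
    then obtain x where x: "x \<noteq> 0" "poly P x = 0" by blast
    then have "poly Q x = 0" using less.prems by (metis order_root)
    with x obtain P' Q' where PQ: "P = [:-x, 1:] * P'" "Q = [:-x, 1:] * Q'"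
      by (metis dvd_def poly_eq_0_iff_dvd)
    have nz: "P' \<noteq> 0" "Q' \<noteq> 0" using PQ less.prems by auto
    have "degree P = Suc (degree P')" "degree Q = Suc (degree Q')"
      unfolding PQ using nz by (simp_all add: degree_mult_eq del: mult_pCons_left)
    moreover have "order y P' = order y Q'" if "y \<noteq> 0" for y
      using less.prems(1,2) less.prems(4)[OF that] unfolding PQ by (simp add: order_mult del: mult_pCons_left)
    ultimately have "smult (lead_coeff Q') P' = smult (lead_coeff P') Q'"
      using less.hyps[of P' Q'] less.prems(3) nz by (metis lessI old.nat.inject)
    moreover have "lead_coeff P = lead_coeff P'" "lead_coeff Q = lead_coeff Q'"
      unfolding PQ by (simp_all only: lead_coeff_mult) simp_all
    ultimately show ?thesis
      by (simp only: PQ flip: mult_smult_right)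
  qed
qed

section \<open>Divisibility and roots of unity\<close>

text \<open>The factors p i that do not divide n are coprime to n and can be dropped; the remaining ones are
distinct primes, so their product divides d. The bound a * d no longer depends on S, which is
what makes the set of exponents n finite as the tower grows.\<close>

lemma dvd_mult_prod_distinct_primes:
  fixes p :: "'i \<Rightarrow> nat"
  assumes "finite S" "\<And>i. i \<in> S \<Longrightarrow> prime (p i)" "inj_on p S"
    "n dvd a * (\<Prod>i\<in>S. p i)" "\<And>i. i \<in> S \<Longrightarrow> p i dvd n \<Longrightarrow> p i dvd d"
  shows "n dvd a * d"
proof -
  define T where "T = {i \<in> S. p i dvd n}"
  have "coprime n (\<Prod>i\<in>S-T. p i)"
    using assms(2) by (intro prod_coprime_right) (auto simp: T_def intro: coprime_commute[THEN iffD1] prime_imp_coprime)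
  moreover have "(\<Prod>i\<in>S. p i) = (\<Prod>i\<in>T. p i) * (\<Prod>i\<in>S-T. p i)"
    using assms(1) by (subst prod.subset_diff[of T]) (auto simp: T_def mult.commute)
  ultimately have "n dvd a * (\<Prod>i\<in>T. p i)"
    using assms(4) by (metis coprime_dvd_mult_left_iff mult.assoc)
  moreover have "(\<Prod>i\<in>T. p i) dvd d"
  proof -
    have "finite T" using assms(1) by (simp add: T_def)
    moreover have "prime (p i)" "p i dvd d" if "i \<in> T" for i
      using that assms(2,5) by (auto simp: T_def)
    moreover have "inj_on p T" using assms(3) by (rule inj_on_subset) (auto simp: T_def)
    ultimately show ?thesis
    proof (induction T rule: finite_induct)
      case (insert i T)
      have "coprime (p i) (\<Prod>j\<in>T. p j)"
        using insert by (intro prod_coprime_right primes_coprime) auto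
      then show ?case using insert by (simp add: divides_mult)
    qed auto
  qed
  ultimately show ?thesis by (meson dvd_trans mult_dvd_mono dvd_refl)
qed

text \<open>Raising to the power l is invertible on a cyclic group of order prime to l.\<close>

lemma coprime_order_imp_power:
  fixes x :: "'a::field"
  assumes "x ^ r = 1" "coprime l r" "l > 0"
  shows "\<exists>m. x = (x ^ m) ^ l"
proof -
  obtain u v where uv: "l * u = r * v + 1"
    using bezout_nat[of l r] assms(2,3) by auto
  have "(x ^ u) ^ l = x ^ (r * v + 1)"
    by (metis power_mult mult.commute uv)
  also have "\<dots> = x"
    by (simp add: power_mult assms(1))
  finally show ?thesis by metis
qed

text \<open>A root of 1 + X + ... + X^(l-1); it differs from 1 because l is nonzero in the field.\<close>

lemma nontrivial_root_of_unity_exists: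
  assumes "of_nat l \<noteq> (0::'a::alg_closed_field)" "l > 1"
  obtains \<omega> :: "'a::alg_closed_field" where "\<omega> \<noteq> 1" "\<omega> ^ l = 1"
proof -
  obtain \<omega> :: 'a where \<omega>: "(\<Sum>i\<le>l - 1. 1 * \<omega> ^ i) = 0"
    using alg_closed[of "l - 1" "\<lambda>_. 1"] assms(2) by auto
  have "{..l - 1} = {..<l}" using assms(2) by auto
  then have sum: "(\<Sum>i<l. \<omega> ^ i) = 0" using \<omega> by simp
  have "\<omega> ^ l - 1 = (\<omega> - 1) * (\<Sum>i<l. \<omega> ^ i)" by (rule power_diff_1_eq)
  then have "\<omega> ^ l = 1" using sum by simp
  moreover have "\<omega> \<noteq> 1" using sum assms(1) by auto
  ultimately show ?thesis using that by blast
qed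

lemma finite_roots_of_unity:
  assumes "n > 0"
  shows "finite {x :: 'a::idom. x ^ n = 1}"
proof -
  let ?p = "monom 1 n - 1 :: 'a poly"
  have "degree (monom 1 n :: 'a poly) \<noteq> degree (1 :: 'a poly)"
    using assms by (simp add: degree_monom_eq)
  then have "?p \<noteq> 0" by auto
  then have "finite {x. poly ?p x = 0}" by (rule poly_roots_finite)
  then show ?thesis by (simp add: poly_monom)
qed

text \<open>The l-th power map of the finite group of roots of unity of order dividing l^v has a nontrivial
kernel, so it is not surjective.\<close>

lemma non_power_of_prime_power_order:
  assumes "of_nat l \<noteq> (0::'a::alg_closed_field)" "l > 1" "v > 0"
  obtains \<zeta> :: "'a::alg_closed_field" where "\<zeta> ^ (l ^ v) = 1" "\<And>y. y ^ (l ^ v) = 1 \<Longrightarrow> y ^ l \<noteq> \<zeta>"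
proof -
  let ?\<mu> = "{x :: 'a. x ^ (l ^ v) = 1}" and ?f = "\<lambda>x::'a. x ^ l"
  have fin: "finite ?\<mu>" using assms(2) by (intro finite_roots_of_unity) simp
  obtain \<omega> :: 'a where \<omega>: "\<omega> \<noteq> 1" "\<omega> ^ l = 1"
    using nontrivial_root_of_unity_exists assms by metis
  have "l ^ v = l * l ^ (v - 1)" using assms(3) by (cases v) auto
  then have "\<omega> \<in> ?\<mu>" using \<omega>(2) by (simp add: power_mult)
  moreover have "1 \<in> ?\<mu>" "?f \<omega> = ?f 1" using \<omega>(2) by simp_all
  ultimately have "\<not> inj_on ?f ?\<mu>" using \<omega>(1) by (meson inj_onD)
  then have "\<not> ?\<mu> \<subseteq> ?f ` ?\<mu>" using finite_surj_inj[OF fin] by blast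
  then show ?thesis using that by blast
qed

section \<open>Subfields and their groups of powers\<close>

text \<open>Closure under division is demanded for every y, since x / 0 = 0 and 0 = 1 - 1 is an element anyway.\<close>

definition is_subfield :: "'a::field set \<Rightarrow> bool" where
  "is_subfield K \<longleftrightarrow> 1 \<in> K \<and> (\<forall>x\<in>K. \<forall>y\<in>K. x - y \<in> K \<and> x / y \<in> K)"

lemma is_subfieldD:
  assumes "is_subfield K"
  shows "1 \<in> K" "0 \<in> K" "x \<in> K \<Longrightarrow> y \<in> K \<Longrightarrow> x - y \<in> K" "x \<in> K \<Longrightarrow> y \<in> K \<Longrightarrow> x / y \<in> K"
    "x \<in> K \<Longrightarrow> - x \<in> K" "x \<in> K \<Longrightarrow> y \<in> K \<Longrightarrow> x + y \<in> K" "x \<in> K \<Longrightarrow> inverse x \<in> K"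
    "x \<in> K \<Longrightarrow> y \<in> K \<Longrightarrow> x * y \<in> K"
proof -
  show 1: "1 \<in> K" and minus: "\<And>x y. x \<in> K \<Longrightarrow> y \<in> K \<Longrightarrow> x - y \<in> K"
    and divide: "\<And>x y. x \<in> K \<Longrightarrow> y \<in> K \<Longrightarrow> x / y \<in> K"
    using assms by (auto simp: is_subfield_def)
  show 0: "0 \<in> K" using minus[OF 1 1] by simp
  show neg: "- x \<in> K" if "x \<in> K" for x using minus[OF 0 that] by simp
  show "x + y \<in> K" if "x \<in> K" "y \<in> K" for x y using minus[OF that(1) neg[OF that(2)]] by simp
  show inv: "inverse x \<in> K" if "x \<in> K" for x using divide[OF 1 that] by (simp add: inverse_eq_divide)
  show "x * y \<in> K" if "x \<in> K" "y \<in> K" for x y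
    using divide[OF that(1) inv[OF that(2)]] by (simp add: divide_inverse)
qed

lemma is_subfield_power: "is_subfield K \<Longrightarrow> x \<in> K \<Longrightarrow> x ^ n \<in> K"
  by (induction n) (auto intro: is_subfieldD)

lemma is_subfield_sum: "is_subfield K \<Longrightarrow> (\<And>i. i \<in> S \<Longrightarrow> f i \<in> K) \<Longrightarrow> sum f S \<in> K"
  by (induction S rule: infinite_finite_induct) (auto intro: is_subfieldD)

definition polys_over :: "'a::field set \<Rightarrow> 'a poly set" where
  "polys_over k = {P. \<forall>i. coeff P i \<in> k}"

lemma polys_over_closed:
  assumes "is_subfield k"
  shows "P \<in> polys_over k \<Longrightarrow> Q \<in> polys_over k \<Longrightarrow> P + Q \<in> polys_over k"
    "P \<in> polys_over k \<Longrightarrow> Q \<in> polys_over k \<Longrightarrow> P - Q \<in> polys_over k"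
    "P \<in> polys_over k \<Longrightarrow> Q \<in> polys_over k \<Longrightarrow> P * Q \<in> polys_over k"
    "c \<in> k \<Longrightarrow> [:c:] \<in> polys_over k"
    "1 \<in> polys_over k"
    "c \<in> k \<Longrightarrow> monom c n \<in> polys_over k"
  using assms
  by (auto simp: polys_over_def coeff_mult coeff_pCons coeff_1
      intro!: is_subfieldD is_subfield_sum split: nat.splits)

lemma polys_over_pcompose:
  assumes "is_subfield k" "Q \<in> polys_over k" "P \<in> polys_over k"
  shows "pcompose P Q \<in> polys_over k"
  using assms(3)
proof (induction P)
  case 0
  show ?case using is_subfieldD(2)[OF assms(1)] by (simp add: polys_over_def)
next
  case (pCons a P)
  note coeffs = pCons.prems[unfolded polys_over_def mem_Collect_eq, rule_format]
  have "a \<in> k" using coeffs[of 0] by simp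
  moreover have "coeff P i \<in> k" for i using coeffs[of "Suc i"] by simp
  then have "P \<in> polys_over k" by (simp add: polys_over_def)
  ultimately show ?case
    unfolding pcompose_pCons
    by (intro polys_over_closed(1,3,4) assms(1,2) pCons.IH)
qed

lemma countable_polys_over:
  assumes "countable k" shows "countable (polys_over k)"
proof -
  have "P \<in> Poly ` lists k" if "P \<in> polys_over k" for P
  proof -
    have "set (coeffs P) \<subseteq> k"
      using that by (auto simp: polys_over_def coeffs_def)
    then show ?thesis by (metis Poly_coeffs image_eqI in_listsI subset_eq)
  qed
  then have "polys_over k \<subseteq> Poly ` lists k" by blast
  then show ?thesis using assms by (meson countable_image countable_lists countable_subset)
qed

lemma pcompose_eq_0_monom:
  fixes P :: "'a::field poly"
  assumes "c \<noteq> 0" "m > 0"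
  shows "pcompose P (monom c m) = 0 \<longleftrightarrow> P = 0"
  using assms by (intro pcompose_eq_0_iff) (simp add: degree_monom_eq)

text \<open>The subgroup of l-th powers in the multiplicative group of k.\<close>

definition power_group :: "'a::field set \<Rightarrow> nat \<Rightarrow> 'a set" where
  "power_group k l = {x \<in> k. x \<noteq> 0 \<and> (\<exists>y\<in>k. y ^ l = x)}"

lemma power_group_mult:
  assumes "is_subfield k" "x \<in> power_group k l" "y \<in> power_group k l"
  shows "x * y \<in> power_group k l"
proof -
  obtain u v where "u \<in> k" "v \<in> k" "u ^ l = x" "v ^ l = y"
    using assms(2,3) by (auto simp: power_group_def)
  then have "u * v \<in> k" "(u * v) ^ l = x * y"
    using is_subfieldD(8)[OF assms(1)] by (auto simp: power_mult_distrib)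
  then show ?thesis using assms is_subfieldD(8)[OF assms(1)] by (auto simp: power_group_def)
qed

lemma power_group_divide:
  assumes "is_subfield k" "x \<in> power_group k l" "y \<in> power_group k l"
  shows "x / y \<in> power_group k l"
proof -
  obtain u v where "u \<in> k" "v \<in> k" "u ^ l = x" "v ^ l = y"
    using assms(2,3) by (auto simp: power_group_def)
  then have "u / v \<in> k" "(u / v) ^ l = x / y"
    using is_subfieldD(4)[OF assms(1)] by (auto simp: power_divide)
  then show ?thesis using assms is_subfieldD(4)[OF assms(1)] by (auto simp: power_group_def)
qed

lemma power_group_1: "is_subfield k \<Longrightarrow> 1 \<in> power_group k l"
  using is_subfieldD(1)[of k] by (force simp: power_group_def)

lemma power_group_power:
  "is_subfield k \<Longrightarrow> x \<in> power_group k l \<Longrightarrow> x ^ n \<in> power_group k l"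
  by (induction n) (auto intro: power_group_mult power_group_1)

lemma power_group_power_self:
  "is_subfield k \<Longrightarrow> x \<in> k \<Longrightarrow> x \<noteq> 0 \<Longrightarrow> x ^ l \<in> power_group k l"
  unfolding power_group_def by (auto intro: is_subfield_power)

lemma power_group_coprime_order:
  assumes "is_subfield k" "x \<in> k" "x \<noteq> 0" "x ^ r = 1" "coprime l r" "l > 0"
  shows "x \<in> power_group k l"
proof -
  obtain m where "x = (x ^ m) ^ l" using coprime_order_imp_power assms by blast
  then show ?thesis using power_group_power_self[of k "x ^ m" l] assms
    by (simp add: is_subfield_power)
qed

text \<open>The quotient of the multiplicative group by the l-th powers is killed by l, so an exponent prime
to l acts invertibly on it.\<close>

lemma power_group_coprime_exponent:
  assumes "is_subfield k" "x \<in> k" "x \<noteq> 0" "x ^ m \<in> power_group k l" "coprime m l" "m > 0"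
  shows "x \<in> power_group k l"
proof -
  obtain u v where uv: "m * u = l * v + 1"
    using bezout_nat[of m l] assms(5,6) by auto
  have "(x ^ m) ^ u = x ^ (v * l + 1)"
    by (simp only: uv mult.commute[of v] flip: power_mult)
  then have "(x ^ m) ^ u = (x ^ v) ^ l * x"
    by (simp add: power_mult)
  then have "x = (x ^ m) ^ u / (x ^ v) ^ l" using assms(3) by (simp add: field_simps)
  moreover have "(x ^ v) ^ l \<in> power_group k l"
    using assms by (intro power_group_power_self is_subfield_power) auto
  ultimately show ?thesis
    using power_group_divide[OF assms(1) power_group_power[OF assms(1,4)]] by metis
qed

section \<open>A tower of twisted radical extensions\<close>

text \<open>The constants of the construction. The order of \<zeta> j is a power of l j so that \<zeta> i is an l j-th power
for every i \<noteq> j: each prime l j sees only its own \<zeta> j.\<close>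

locale torsion_field =
  fixes k :: "'c::alg_closed_field set" and \<zeta> :: "nat \<Rightarrow> 'c" and l :: "nat \<Rightarrow> nat"
  assumes k_subfield: "is_subfield k"
    and k_countable: "countable k"
    and k_torsion: "x \<in> k \<Longrightarrow> x \<noteq> 0 \<Longrightarrow> \<exists>r>0. x ^ r = 1"
    and l_prime: "prime (l j)"
    and l_inj: "inj l"
    and l_char: "of_nat (l j) \<noteq> (0::'c)"
    and \<zeta>_in: "\<zeta> j \<in> k"
    and \<zeta>_order: "\<exists>v. \<zeta> j ^ (l j ^ v) = 1"
    and \<zeta>_not_power: "y \<in> k \<Longrightarrow> y ^ l j \<noteq> \<zeta> j"
begin

lemma l_gt_0: "l j > 0" and l_gt_1: "l j > 1"
  using l_prime[of j] prime_gt_0_nat prime_gt_1_nat by auto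

lemma \<zeta>_nz: "\<zeta> j \<noteq> 0"
  using \<zeta>_order[of j] l_gt_0[of j] by (auto simp: power_0_left split: if_splits)

end

text \<open>The map e J stands for the evaluation of polynomials at a generator s_J of the J-th field of the
tower; injectivity says that s_J is transcendental over the constants, and e_step encodes the
relation s_J = \<zeta>_J s_(J+1)^(l_J). The polynomials may have coefficients in the whole
algebraically closed field, where roots are available, while the field built below uses only
those with coefficients in k.\<close>

locale radical_tower = torsion_field k \<zeta> l
  for k :: "'c::alg_closed_field set" and \<zeta> :: "nat \<Rightarrow> 'c" and l :: "nat \<Rightarrow> nat" +
  fixes e :: "nat \<Rightarrow> 'c poly \<Rightarrow> 'l::field"
  assumes e_add: "e J (P + Q) = e J P + e J Q"
    and e_mult: "e J (P * Q) = e J P * e J Q"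
    and e_1: "e J 1 = 1"
    and e_eq_0D: "e J P = 0 \<Longrightarrow> P = 0"
    and e_step: "e J P = e (Suc J) (pcompose P (monom (\<zeta> J) (l J)))"
begin

text \<open>Iterating the relations gives s_J = step_unit J d * s_(J+d)^(step_exp J d).\<close>

definition step_exp :: "nat \<Rightarrow> nat \<Rightarrow> nat" where
  "step_exp J d = (\<Prod>i<d. l (J + i))"

definition step_unit :: "nat \<Rightarrow> nat \<Rightarrow> 'c" where
  "step_unit J d = (\<Prod>i<d. \<zeta> (J + i) ^ step_exp J i)"

abbreviation lift :: "nat \<Rightarrow> nat \<Rightarrow> 'c poly \<Rightarrow> 'c poly" where
  "lift J d P \<equiv> pcompose P (monom (step_unit J d) (step_exp J d))"

definition tower_field :: "'l set" where
  "tower_field = {e J P / e J Q | J P Q. P \<in> polys_over k \<and> Q \<in> polys_over k \<and> Q \<noteq> 0}"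

lemma step_exp_gt_0: "step_exp J d > 0"
  unfolding step_exp_def using l_gt_0 by (simp add: prod_pos)

lemma step_unit_nz: "step_unit J d \<noteq> 0"
  unfolding step_unit_def using \<zeta>_nz by simp

lemma step_unit_in: "step_unit J d \<in> k"
  unfolding step_unit_def
  by (induction d) (auto intro!: is_subfieldD[OF k_subfield] is_subfield_power \<zeta>_in k_subfield)

lemma step_exp_char: "of_nat (step_exp J d) \<noteq> (0::'c)"
  unfolding step_exp_def using l_char by simp

lemma e_0 [simp]: "e J 0 = 0"
  by (metis add.right_neutral add_left_cancel e_add)

lemma e_eq_0 [simp]: "e J P = 0 \<longleftrightarrow> P = 0"
  using e_eq_0D by auto

lemma e_diff: "e J (P - Q) = e J P - e J Q"
  using e_add[of J "P - Q" Q] by simp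

lemma e_inj: "e J P = e J Q \<Longrightarrow> P = Q"
  using e_eq_0D[of J "P - Q"] by (simp add: e_diff)

lemma e_power: "e J (P ^ n) = e J P ^ n"
  by (induction n) (simp_all add: e_1 e_mult)

lemma e_lift: "e J P = e (J + d) (lift J d P)"
proof (induction d)
  case 0
  have "monom 1 1 = ([:0, 1:] :: 'c poly)" by (simp add: monom_Suc monom_0)
  then show ?case by (simp add: step_exp_def step_unit_def)
next
  case (Suc d)
  let ?a = "monom (step_unit J d) (step_exp J d)" and ?b = "monom (\<zeta> (J + d)) (l (J + d))"
  have "pcompose ?a ?b = monom (step_unit J (Suc d)) (step_exp J (Suc d))"
  proof -
    have "?a = smult (step_unit J d) ([:0, 1:] ^ step_exp J d)" by (simp add: monom_altdef)
    moreover have "pcompose ([:0, 1:] ^ n) ?b = ?b ^ n" for n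
      by (induction n) (simp_all add: pcompose_1 pcompose_mult pcompose_pCons del: mult_pCons_left)
    ultimately have "pcompose ?a ?b = smult (step_unit J d) (?b ^ step_exp J d)"
      by (simp add: pcompose_smult)
    then show ?thesis by (simp add: monom_power smult_monom step_unit_def step_exp_def mult.commute)
  qed
  then have "pcompose (lift J d P) ?b = lift J (Suc d) P"
    by (metis pcompose_assoc)
  then show ?case
    using Suc e_step[of "J + d" "lift J d P"] by simp
qed

lemma lift_polys: "P \<in> polys_over k \<Longrightarrow> lift J d P \<in> polys_over k"
  by (intro polys_over_pcompose polys_over_closed k_subfield step_unit_in)

lemma lift_eq_0 [simp]: "lift J d P = 0 \<longleftrightarrow> P = 0"
  by (rule pcompose_eq_0_monom[OF step_unit_nz step_exp_gt_0])

lemma tower_field_lift: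
  assumes "y \<in> tower_field"
  obtains d A B where "A \<in> polys_over k" "B \<in> polys_over k" "B \<noteq> 0" "y = e (J + d) A / e (J + d) B"
proof -
  obtain I P Q where *: "P \<in> polys_over k" "Q \<in> polys_over k" "Q \<noteq> 0" "y = e I P / e I Q"
    using assms by (auto simp: tower_field_def)
  show ?thesis
  proof (rule that)
    show "y = e (J + I) (lift I J P) / e (J + I) (lift I J Q)"
      using * e_lift[of I P J] e_lift[of I Q J] by (simp add: add.commute)
  qed (use * lift_polys in auto)
qed

lemma tower_field_subfield: "is_subfield tower_field"
proof -
  have tower_field_memI: "e J P / e J Q \<in> tower_field" if "P \<in> polys_over k" "Q \<in> polys_over k" "Q \<noteq> 0" for J P Q
    unfolding tower_field_def using that by blast
  have "e 0 1 / e 0 1 \<in> tower_field" by (intro tower_field_memI polys_over_closed k_subfield) auto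
  then have 1: "1 \<in> tower_field" by (simp add: e_1)
  moreover have "x - y \<in> tower_field \<and> x / y \<in> tower_field" if xy: "x \<in> tower_field" "y \<in> tower_field" for x y
  proof -
    obtain J P Q where x: "P \<in> polys_over k" "Q \<in> polys_over k" "Q \<noteq> 0" "x = e J P / e J Q"
      using xy(1) by (auto simp: tower_field_def)
    obtain d A B where y: "A \<in> polys_over k" "B \<in> polys_over k" "B \<noteq> 0"
      "y = e (J + d) A / e (J + d) B" using tower_field_lift[OF xy(2)] by metis
    let ?P = "lift J d P" and ?Q = "lift J d Q" and ?J = "J + d"
    have x': "x = e ?J ?P / e ?J ?Q" "?P \<in> polys_over k" "?Q \<in> polys_over k" "?Q \<noteq> 0"
      using x e_lift[of J _ d] lift_polys by auto
    have "x - y = e ?J (?P * B - A * ?Q) / e ?J (?Q * B)"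
      using x' y by (simp add: e_diff e_mult diff_frac_eq)
    also have "\<dots> \<in> tower_field"
      using x' y by (intro tower_field_memI polys_over_closed k_subfield) auto
    finally have "x - y \<in> tower_field" .
    moreover have "x / y \<in> tower_field"
    proof (cases "A = 0")
      case True
      then have "x / y = 1 - 1" using y by simp
      also have "1 - 1 = e 0 0 / e 0 1" by simp
      also have "\<dots> \<in> tower_field" using k_subfield is_subfieldD(2)[OF k_subfield]
        by (intro tower_field_memI polys_over_closed) (auto simp: polys_over_def)
      finally show ?thesis .
    next
      case False
      have "x / y = e ?J (?P * B) / e ?J (?Q * A)"
        using x' y by (simp add: e_mult)
      also have "\<dots> \<in> tower_field"
        using x' y False by (intro tower_field_memI polys_over_closed k_subfield) auto
      finally show ?thesis .
    qed
    ultimately show ?thesis by simp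
  qed
  ultimately show ?thesis unfolding is_subfield_def by blast
qed

lemma tower_field_countable: "countable tower_field"
proof -
  have "tower_field \<subseteq> (\<lambda>(J, P, Q). e J P / e J Q) ` (UNIV \<times> polys_over k \<times> polys_over k)"
    by (force simp: tower_field_def)
  moreover have "countable (UNIV \<times> polys_over k \<times> polys_over k :: (nat \<times> _) set)"
    using countable_polys_over[OF k_countable] by simp
  ultimately show ?thesis by (meson countable_image countable_subset)
qed

text \<open>Modulo l_j-th powers, only the factor \<zeta>_j of the constant that relates two levels survives, and
its exponent is a product of primes different from l_j.\<close>

lemma step_unit_power_class:
  shows "j \<notin> {J..<J+d} \<Longrightarrow> step_unit J d \<in> power_group k (l j)"
    and "j \<in> {J..<J+d} \<Longrightarrow> \<exists>x n. step_unit J d = x * \<zeta> j ^ n \<and> x \<in> power_group k (l j) \<and> coprime n (l j)"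
proof (induction d)
  case 0
  { case 1 show ?case by (simp add: step_unit_def power_group_1 k_subfield) }
  { case 2 then show ?case by simp }
next
  case (Suc d)
  have Suc_c: "step_unit J (Suc d) = step_unit J d * \<zeta> (J + d) ^ step_exp J d" by (simp add: step_unit_def)
  have other: "\<zeta> i ^ n \<in> power_group k (l j)" if ij: "i \<noteq> j" for i n
  proof (rule power_group_power[OF k_subfield])
    obtain v where "\<zeta> i ^ (l i ^ v) = 1" using \<zeta>_order by blast
    moreover have "coprime (l j) (l i ^ v)"
      using l_prime ij l_inj by (simp add: primes_coprime inj_eq)
    ultimately show "\<zeta> i \<in> power_group k (l j)"
      using power_group_coprime_order[OF k_subfield \<zeta>_in \<zeta>_nz] l_gt_0 by blast
  qed
  { case 1
    then show ?case
      unfolding Suc_c using Suc.IH(1) other[of "J + d"]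
      by (intro power_group_mult[OF k_subfield]) auto }
  { case 2
    show ?case
    proof (cases "j = J + d")
      case True
      then have "step_unit J d \<in> power_group k (l j)" using Suc.IH(1) by simp
      moreover have "coprime (step_exp J d) (l j)"
        unfolding step_exp_def True using l_prime l_inj
        by (intro prod_coprime_left primes_coprime) (auto simp: inj_eq)
      ultimately show ?thesis unfolding Suc_c True by blast
    next
      case False
      then obtain x n where xn: "step_unit J d = x * \<zeta> j ^ n" "x \<in> power_group k (l j)" "coprime n (l j)"
        using 2 Suc.IH(2) by auto
      have "step_unit J (Suc d) = (x * \<zeta> (J + d) ^ step_exp J d) * \<zeta> j ^ n"
        unfolding Suc_c xn(1) by simp
      moreover have "x * \<zeta> (J + d) ^ step_exp J d \<in> power_group k (l j)"
        using xn(2) other[of "J + d"] False by (intro power_group_mult[OF k_subfield]) auto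
      ultimately show ?thesis using xn(3) by blast
    qed }
qed

text \<open>Otherwise \<zeta>_j raised to an exponent prime to l_j, and then \<zeta>_j itself, would be an l_j-th power.\<close>

lemma step_unit_not_power:
  assumes "j \<in> {J..<J+d}" "step_unit J d ^ p / step_unit J d ^ q \<in> power_group k (l j)" "p \<noteq> q"
  shows "l j dvd nat \<bar>int p - int q\<bar>"
proof (rule ccontr)
  assume ndvd: "\<not> l j dvd nat \<bar>int p - int q\<bar>"
  have *: False if pw: "step_unit J d ^ p / step_unit J d ^ q \<in> power_group k (l j)" and pq: "p > q"
    and ndvd: "\<not> l j dvd p - q" for p q
  proof -
    obtain x n where xn: "step_unit J d = x * \<zeta> j ^ n" "x \<in> power_group k (l j)" "coprime n (l j)"
      using step_unit_power_class(2)[OF assms(1)] by blast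
    have x0: "x \<noteq> 0" using xn(2) by (simp add: power_group_def)
    have "step_unit J d ^ p / step_unit J d ^ q = step_unit J d ^ (p - q)"
      using pq step_unit_nz by (simp add: power_diff)
    also have "\<dots> = x ^ (p - q) * \<zeta> j ^ (n * (p - q))"
      by (simp add: xn(1) power_mult_distrib power_mult)
    finally have "\<zeta> j ^ (n * (p - q)) = (step_unit J d ^ p / step_unit J d ^ q) / x ^ (p - q)"
      using x0 by simp
    also have "\<dots> \<in> power_group k (l j)"
      by (rule power_group_divide[OF k_subfield pw power_group_power[OF k_subfield xn(2)]])
    finally have "\<zeta> j ^ (n * (p - q)) \<in> power_group k (l j)" .
    moreover have "coprime (p - q) (l j)"
      using ndvd l_prime prime_imp_coprime coprime_commute by blast
    then have "coprime (n * (p - q)) (l j)" using xn(3) by simp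
    moreover have "n > 0" using xn(3) l_gt_1[of j] by (cases n) auto
    ultimately have "\<zeta> j \<in> power_group k (l j)"
      using power_group_coprime_exponent[OF k_subfield \<zeta>_in \<zeta>_nz] pq by simp
    then show False using \<zeta>_not_power by (auto simp: power_group_def)
  qed
  show False
  proof (cases "p > q")
    case True
    then show False using *[OF assms(2)] ndvd by (simp add: nat_diff_distrib)
  next
    case False
    have "1 / (step_unit J d ^ p / step_unit J d ^ q) \<in> power_group k (l j)"
      by (rule power_group_divide[OF k_subfield power_group_1[OF k_subfield] assms(2)])
    then have "step_unit J d ^ q / step_unit J d ^ p \<in> power_group k (l j)" by simp
    then show False using *[of q p] ndvd False assms(3) by (simp add: nat_diff_distrib abs_if)
  qed
qed

text \<open>An n-th root of P / Q, taken at a higher level, as an identity between polynomials.\<close>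

lemma root_equation:
  assumes "Q \<noteq> 0" "B \<noteq> 0" "(e (J + d) A / e (J + d) B) ^ n = e J P / e J Q"
  shows "A ^ n * lift J d Q = B ^ n * lift J d P"
proof (rule e_inj)
  show "e (J + d) (A ^ n * lift J d Q) = e (J + d) (B ^ n * lift J d P)"
    using assms by (simp add: e_mult e_power flip: e_lift) (simp add: field_simps)
qed

text \<open>The degrees alone give that n divides a times the product of the primes l_J, ..., l_(J+d-1).
The leading coefficients show that such a prime l_j can divide n only if it divides a * r:
otherwise the leading coefficient of P / Q, of order prime to l_j, is an l_j-th power, so the a-th
power of step_unit J d is one up to inversion, which contradicts the choice of \<zeta>_j.\<close>

lemma root_exponent_dvd_degree:
  assumes "P \<in> polys_over k" "Q \<in> polys_over k" "A \<in> polys_over k" "B \<in> polys_over k"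
    and nz: "P \<noteq> 0" "Q \<noteq> 0" "A \<noteq> 0" "B \<noteq> 0"
    and eq: "A ^ n * lift J d Q = B ^ n * lift J d P"
    and deg: "degree P \<noteq> degree Q"
    and r: "(lead_coeff P / lead_coeff Q) ^ r = 1"
  defines "a \<equiv> nat \<bar>int (degree P) - int (degree Q)\<bar>"
  shows "n dvd a * (a * r)"
proof -
  have dm: "degree (monom (step_unit J d) (step_exp J d)) = step_exp J d" using step_unit_nz by (simp add: degree_monom_eq)
  have lead_coeff_lift: "lead_coeff (lift J d R) = lead_coeff R * step_unit J d ^ degree R" for R
    by (subst lead_coeff_comp) (simp_all add: dm step_exp_gt_0)
  have "degree (A ^ n * lift J d Q) = n * degree A + degree Q * step_exp J d"
    using nz by (simp add: degree_mult_eq degree_power_eq degree_pcompose dm)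
  moreover have "degree (B ^ n * lift J d P) = n * degree B + degree P * step_exp J d"
    using nz by (simp add: degree_mult_eq degree_power_eq degree_pcompose dm)
  ultimately have "n * degree A + degree Q * step_exp J d = n * degree B + degree P * step_exp J d"
    using eq by simp
  then have "int n * (int (degree A) - int (degree B)) = (int (degree P) - int (degree Q)) * int (step_exp J d)"
    by (simp add: algebra_simps flip: of_nat_mult of_nat_add)
  then have "int n dvd (int (degree P) - int (degree Q)) * int (step_exp J d)"
    by (metis dvd_triv_left)
  then have "int n dvd \<bar>int (degree P) - int (degree Q)\<bar> * int (step_exp J d)"
    by (metis abs_mult abs_of_nat dvd_abs_iff)
  then have "int n dvd int (a * step_exp J d)" by (simp add: a_def)
  then have n_dvd: "n dvd a * step_exp J d" by (simp only: int_dvd_int_iff)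
  have prod: "step_exp J d = prod l {J..<J+d}"
    unfolding step_exp_def by (rule prod.reindex_bij_witness[of _ "\<lambda>i. i - J" "\<lambda>i. J + i"]) auto
  have dvd: "l j dvd a * r" if j: "j \<in> {J..<J+d}" and ln: "l j dvd n" for j
  proof (rule ccontr)
    assume "\<not> l j dvd a * r"
    then have na: "\<not> l j dvd a" and nr: "\<not> l j dvd r" by auto
    have lcP: "lead_coeff P \<in> k" "lead_coeff Q \<in> k" "lead_coeff A \<in> k" "lead_coeff B \<in> k"
      using assms(1-4) by (auto simp: polys_over_def)
    have lc: "lead_coeff A ^ n * (lead_coeff Q * step_unit J d ^ degree Q) =
      lead_coeff B ^ n * (lead_coeff P * step_unit J d ^ degree P)"
      using arg_cong[OF eq, of lead_coeff] step_exp_gt_0[of J d] dm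
      by (simp only: lead_coeff_mult lead_coeff_power lead_coeff_lift)
    let ?D = "lead_coeff P / lead_coeff Q" and ?U = "lead_coeff A / lead_coeff B"
    have D: "?D \<in> power_group k (l j)"
    proof (rule power_group_coprime_order[OF k_subfield _ _ r])
      show "coprime (l j) r" using nr l_prime prime_imp_coprime by blast
    qed (use lcP nz l_gt_0 k_subfield in \<open>auto intro: is_subfieldD\<close>)
    obtain q where q: "n = q * l j" using ln by (metis dvd_def mult.commute)
    have "?U ^ n \<in> power_group k (l j)"
      unfolding q power_mult using lcP nz k_subfield
      by (intro power_group_power_self is_subfield_power is_subfieldD) auto
    moreover have "step_unit J d ^ degree P / step_unit J d ^ degree Q = ?U ^ n / ?D"
      using lc nz step_unit_nz[of J d] by (simp add: power_divide field_simps)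
    ultimately have "step_unit J d ^ degree P / step_unit J d ^ degree Q \<in> power_group k (l j)"
      using power_group_divide[OF k_subfield _ D] by metis
    then show False using step_unit_not_power[OF j _ deg] na by (simp add: a_def)
  qed
  show ?thesis
    by (rule dvd_mult_prod_distinct_primes[OF _ l_prime inj_on_subset[OF l_inj] n_dvd[unfolded prod] dvd])
      auto
qed

text \<open>Away from 0 the multiplicities at level J are those at level J + d, where the exponent n is visible.\<close>

lemma root_exponent_dvd_order:
  assumes nz: "P \<noteq> 0" "Q \<noteq> 0" "A \<noteq> 0" "B \<noteq> 0"
    and eq: "A ^ n * lift J d Q = B ^ n * lift J d P"
    and "\<alpha> \<noteq> 0"
  shows "int n dvd int (order \<alpha> P) - int (order \<alpha> Q)"
proof -
  obtain \<beta> where "\<beta> ^ step_exp J d = \<alpha> / step_unit J d"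
    using nth_root_exists[OF step_exp_gt_0] by blast
  then have \<beta>: "step_unit J d * \<beta> ^ step_exp J d = \<alpha>" using step_unit_nz by simp
  have ord: "order \<beta> (lift J d R) = order \<alpha> R" if "R \<noteq> 0" for R
    using order_pcompose_monom[OF \<beta> assms(6) step_exp_char that] .
  have pow: "order \<beta> (R ^ n) = n * order \<beta> R" if "R \<noteq> 0" for R :: "'c poly" and n
    using that by (induction n) (auto simp: order_mult)
  have "n * order \<beta> A + order \<alpha> Q = n * order \<beta> B + order \<alpha> P"
    using arg_cong[OF eq, of "order \<beta>"] nz by (simp add: order_mult pow ord)
  then have "int (order \<alpha> P) - int (order \<alpha> Q) = int n * (int (order \<beta> A) - int (order \<beta> B))"
    by (simp add: algebra_simps flip: of_nat_mult of_nat_add)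
  then show ?thesis by simp
qed

text \<open>A nonconstant element has a nonzero valuation either at infinity (the degree) or at some \<alpha> \<noteq> 0; each case
bounds n independently of the level that contains the root. Constants are torsion.\<close>

theorem tower_field_finite_roots:
  assumes x: "x \<in> tower_field" "x \<noteq> 0" and nt: "\<And>n. n \<ge> 1 \<Longrightarrow> x ^ n \<noteq> 1"
  shows "finite {n. n \<ge> 1 \<and> (\<exists>y\<in>tower_field. y ^ n = x)}"
proof -
  obtain J P Q where PQ: "P \<in> polys_over k" "Q \<in> polys_over k" "Q \<noteq> 0" "x = e J P / e J Q"
    using x(1) by (auto simp: tower_field_def)
  have P0: "P \<noteq> 0" using x PQ by auto
  have D: "lead_coeff P / lead_coeff Q \<in> k" "lead_coeff P / lead_coeff Q \<noteq> 0"
    using PQ P0 k_subfield by (auto simp: polys_over_def intro: is_subfieldD)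
  then obtain r where r: "r > 0" "(lead_coeff P / lead_coeff Q) ^ r = 1"
    using k_torsion by blast
  have root: "\<exists>d A B. A \<in> polys_over k \<and> B \<in> polys_over k \<and> A \<noteq> 0 \<and> B \<noteq> 0 \<and>
      A ^ n * lift J d Q = B ^ n * lift J d P" if n: "n \<ge> 1" "y \<in> tower_field" "y ^ n = x" for n y
  proof -
    obtain d A B where AB: "A \<in> polys_over k" "B \<in> polys_over k" "B \<noteq> 0"
      "y = e (J + d) A / e (J + d) B" using tower_field_lift[OF n(2)] by metis
    moreover have "A \<noteq> 0" using AB n x by auto
    moreover have "A ^ n * lift J d Q = B ^ n * lift J d P"
      using AB PQ n by (intro root_equation) auto
    ultimately show ?thesis by blast
  qed
  consider (degree) "degree P \<noteq> degree Q"
    | (zero) \<alpha> where "\<alpha> \<noteq> 0" and "order \<alpha> P \<noteq> order \<alpha> Q"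
    | (const) "degree P = degree Q" and "\<And>\<alpha>. \<alpha> \<noteq> 0 \<Longrightarrow> order \<alpha> P = order \<alpha> Q"
    by blast
  then show ?thesis
  proof cases
    case degree
    define a where "a = nat \<bar>int (degree P) - int (degree Q)\<bar>"
    have dvd: "n dvd a * (a * r)" if n: "n \<ge> 1" "y \<in> tower_field" "y ^ n = x" for n y
    proof -
      obtain d A B where AB: "A \<in> polys_over k" "B \<in> polys_over k" "A \<noteq> 0" "B \<noteq> 0"
        "A ^ n * lift J d Q = B ^ n * lift J d P" using root[OF n] by blast
      show ?thesis
        unfolding a_def by (rule root_exponent_dvd_degree[OF PQ(1,2) AB(1,2) P0 PQ(3) AB(3-5) degree r(2)])
    qed
    have "a * (a * r) > 0" using degree r by (simp add: a_def)
    then have "finite {n. n dvd a * (a * r)}" by (rule finite_divisors_nat)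
    then show ?thesis by (rule finite_subset[rotated]) (use dvd in blast)
  next
    case zero
    define a where "a = int (order \<alpha> P) - int (order \<alpha> Q)"
    have dvd: "int n dvd a" if n: "n \<ge> 1" "y \<in> tower_field" "y ^ n = x" for n y
    proof -
      obtain d A B where AB: "A \<noteq> 0" "B \<noteq> 0" "A ^ n * lift J d Q = B ^ n * lift J d P"
        using root[OF n] by blast
      show ?thesis
        unfolding a_def by (rule root_exponent_dvd_order[OF P0 PQ(3) AB zero(1)])
    qed
    have "a \<noteq> 0" using zero by (simp add: a_def)
    have bound: "n \<le> nat \<bar>a\<bar>" if n: "n \<ge> 1" "y \<in> tower_field" "y ^ n = x" for n y
    proof -
      have "\<bar>int n\<bar> \<le> \<bar>a\<bar>"
        using n \<open>a \<noteq> 0\<close> dvd by (intro dvd_imp_le_int) auto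
      then show ?thesis by simp
    qed
    show ?thesis
      by (rule finite_subset[of _ "{..nat \<bar>a\<bar>}"]) (use bound in blast, simp)
  next
    case const
    have "smult (lead_coeff Q) P = smult (lead_coeff P) Q"
      using proportional_if_same_nonzero_roots[OF P0 PQ(3) const] .
    then have "e J [:lead_coeff Q:] * e J P = e J [:lead_coeff P:] * e J Q"
      by (simp flip: e_mult)
    then have "x = e J [:lead_coeff P:] / e J [:lead_coeff Q:]"
      unfolding PQ(4) using PQ(3) by (simp add: frac_eq_eq mult.commute)
    then have "x ^ r = e J ([:lead_coeff P:] ^ r) / e J ([:lead_coeff Q:] ^ r)"
      by (simp only: power_divide e_power)
    also have "\<dots> = e J [:lead_coeff P ^ r:] / e J [:lead_coeff Q ^ r:]"
      by (simp only: poly_const_pow)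
    also have "lead_coeff P ^ r = lead_coeff Q ^ r"
      using r(2) PQ by (simp add: power_divide)
    finally have "x ^ r = 1" using PQ by simp
    then show ?thesis using nt[of r] r by simp
  qed
qed

theorem tower_field_infinite_twisted_roots:
  defines "x \<equiv> e 0 [:0, 1:]"
  shows "x \<in> tower_field" "x \<noteq> 0" "n \<ge> 1 \<Longrightarrow> x ^ n \<noteq> 1"
    "infinite {n. n \<ge> 1 \<and> (\<exists>\<omega>\<in>tower_field. (\<exists>r\<ge>1. \<omega> ^ r = 1) \<and> (\<exists>y\<in>tower_field. y ^ n = \<omega> * x))}"
proof -
  have inK: "e J P \<in> tower_field" if "P \<in> polys_over k" for J P
  proof -
    have "e J P / e J 1 \<in> tower_field"
      unfolding tower_field_def using that polys_over_closed(5)[OF k_subfield] by fastforce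
    then show ?thesis by (simp add: e_1)
  qed
  have X: "[:0, 1:] \<in> polys_over k"
    using k_subfield by (auto simp: polys_over_def coeff_pCons intro: is_subfieldD split: nat.splits)
  show "x \<in> tower_field" unfolding x_def by (rule inK[OF X])
  show "x \<noteq> 0" by (simp add: x_def)
  show "x ^ n \<noteq> 1" if "n \<ge> 1" for n
  proof
    assume "x ^ n = 1"
    then have "e 0 ([:0, 1:] ^ n) = e 0 1" by (simp add: x_def e_power e_1)
    then have "[:0, 1:] ^ n = (1 :: 'c poly)" by (rule e_inj)
    then have "degree ([:0, 1:] ^ n :: 'c poly) = 0" by simp
    then show False using that by (simp add: degree_power_eq)
  qed
  have mem: "step_exp 0 d \<in> {n. n \<ge> 1 \<and> (\<exists>\<omega>\<in>tower_field. (\<exists>r\<ge>1. \<omega> ^ r = 1) \<and> (\<exists>y\<in>tower_field. y ^ n = \<omega> * x))}" for d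
  proof -
    let ?\<omega> = "inverse (e d [:step_unit 0 d:])" and ?y = "e d [:0, 1:]"
    have \<omega>: "?\<omega> \<in> tower_field"
      by (intro is_subfieldD(7)[OF tower_field_subfield] inK polys_over_closed(4)[OF k_subfield step_unit_in])
    obtain r where r: "r > 0" "step_unit 0 d ^ r = 1" using k_torsion[OF step_unit_in step_unit_nz] by blast
    have "e d [:step_unit 0 d:] ^ r = e d [:step_unit 0 d ^ r:]" by (simp only: poly_const_pow flip: e_power)
    then have \<omega>_r: "?\<omega> ^ r = 1" using r(2) e_1[of d] by (simp add: power_inverse one_pCons)
    have "x = e d (monom (step_unit 0 d) (step_exp 0 d))"
      using e_lift[of 0 "[:0, 1:]" d] by (simp add: x_def pcompose_pCons)
    then have "x = e d [:step_unit 0 d:] * ?y ^ step_exp 0 d"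
      by (simp add: monom_altdef flip: e_power e_mult)
    then have "?y ^ step_exp 0 d = ?\<omega> * x" using step_unit_nz by simp
    moreover have "step_exp 0 d \<ge> 1" "r \<ge> 1" using step_exp_gt_0[of 0 d] r(1) by linarith+
    ultimately show ?thesis using \<omega> \<omega>_r inK[OF X] by blast
  qed
  have "step_exp 0 d < step_exp 0 (Suc d)" for d
    using l_gt_1[of d] step_exp_gt_0[of 0 d] by (simp add: step_exp_def)
  then have "strict_mono (step_exp 0)" by (simp add: strict_mono_Suc_iff)
  then have "infinite (range (step_exp 0))" by (simp add: strict_mono_imp_inj_on finite_image_iff)
  then show "infinite {n. n \<ge> 1 \<and> (\<exists>\<omega>\<in>tower_field. (\<exists>r\<ge>1. \<omega> ^ r = 1) \<and> (\<exists>y\<in>tower_field. y ^ n = \<omega> * x))}"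
    using mem infinite_super[of "range (step_exp 0)"] by blast
qed

end

section \<open>The quadratic closure of the field with two elements\<close>

definition fermat :: "nat \<Rightarrow> nat" where "fermat j = 2 ^ 2 ^ j + 1"

text \<open>The multiplicative group of the field with 2^(2^j) elements has quad_order j elements.\<close>

definition quad_order :: "nat \<Rightarrow> nat" where "quad_order j = 2 ^ 2 ^ j - 1"

lemma fermat_quad_order: "fermat j = quad_order j + 2"
  by (simp add: fermat_def quad_order_def)

lemma quad_order_Suc: "quad_order (Suc j) = quad_order j * fermat j"
proof -
  have "(2::nat) ^ 2 ^ Suc j = 2 ^ 2 ^ j * 2 ^ 2 ^ j" by (simp add: mult_2 power_add)
  then show ?thesis by (simp add: fermat_def quad_order_def algebra_simps)
qed

lemma quad_order_dvd: "i \<le> j \<Longrightarrow> quad_order i dvd quad_order j"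
  by (induction j rule: dec_induct) (auto simp: quad_order_Suc)

text \<open>The numbers quad_order j and fermat j are odd and differ by 2.\<close>

lemma fermat_prime_not_dvd_quad_order:
  assumes "prime p" "p dvd fermat j" "i \<le> j"
  shows "\<not> p dvd quad_order i"
proof
  assume "p dvd quad_order i"
  then have "p dvd quad_order j" using quad_order_dvd[OF assms(3)] dvd_trans by blast
  then have "p dvd 2" using assms(2) dvd_add_right_iff[of p "quad_order j" 2] unfolding fermat_quad_order by blast
  then have "p = 2" using assms(1) primes_dvd_imp_eq two_is_prime_nat by blast
  then show False using assms(2) by (simp add: fermat_def)
qed

lemma quad_order_pos: "quad_order j > 0"
proof -
  have "(2::nat) ^ 1 \<le> 2 ^ 2 ^ j" by (intro power_increasing) auto
  then show ?thesis by (simp add: quad_order_def)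
qed

lemma CHAR_gf2: "CHAR(gf2) = 2"
proof -
  have "1 + 1 = (0 :: gf2)" by transfer simp
  then have "of_nat 2 = (0 :: gf2)" by (simp only: of_nat_numeral one_add_one)
  then have "CHAR(gf2) dvd 2" by (simp only: of_nat_eq_0_iff_char_dvd)
  then show ?thesis by (rule primes_dvd_imp_eq[OF CHAR_prime two_is_prime_nat])
qed

lemma fermat_prime_nonzero:
  assumes "prime p" "p dvd fermat j"
  shows "of_nat p \<noteq> (0 :: gf2 alg_closure)"
proof
  assume "of_nat p = (0 :: gf2 alg_closure)"
  then have "2 dvd p" by (simp add: of_nat_eq_0_iff_char_dvd CHAR_gf2)
  then have "2 dvd fermat j" using assms(2) dvd_trans by blast
  then show False by (simp add: fermat_def)
qed

definition F2_quad :: "gf2 alg_closure set" where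
  "F2_quad = {x. \<exists>j. x ^ 2 ^ 2 ^ j = x}"

lemma F2_quad_mono:
  fixes x :: "gf2 alg_closure"
  assumes "x ^ 2 ^ 2 ^ i = x" "i \<le> j" shows "x ^ 2 ^ 2 ^ j = x"
  using assms(2)
proof (induction j rule: dec_induct)
  case (step j)
  have "(2::nat) ^ 2 ^ Suc j = 2 ^ 2 ^ j * 2 ^ 2 ^ j" by (simp add: mult_2 power_add)
  then show ?case using step by (simp add: power_mult)
qed (use assms in auto)

lemma F2_quad_iff:
  assumes "x \<noteq> 0"
  shows "x ^ 2 ^ 2 ^ j = x \<longleftrightarrow> x ^ quad_order j = (1 :: gf2 alg_closure)"
proof -
  have "2 ^ 2 ^ j = quad_order j + 1" by (simp add: quad_order_def)
  then show ?thesis using assms by simp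
qed

lemma F2_quad_subfield: "is_subfield F2_quad"
  unfolding is_subfield_def
proof (intro conjI ballI)
  show "1 \<in> F2_quad" by (simp add: F2_quad_def)
next
  fix x y assume "x \<in> F2_quad" "y \<in> F2_quad"
  then obtain i j where "x ^ 2 ^ 2 ^ i = x" "y ^ 2 ^ 2 ^ j = y" by (auto simp: F2_quad_def)
  then have xy: "x ^ 2 ^ 2 ^ max i j = x" "y ^ 2 ^ 2 ^ max i j = y"
    using F2_quad_mono[of _ _ "max i j"] by auto
  have "CHAR(gf2 alg_closure) = 2" by (simp add: CHAR_gf2)
  then have add: "(u + w) ^ 2 ^ n = u ^ 2 ^ n + w ^ 2 ^ n" for u w :: "gf2 alg_closure" and n
    by (intro freshmans_dream') simp_all
  have "(x - y) ^ 2 ^ 2 ^ max i j + y = x"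
    using add[of "x - y" y "2 ^ max i j"] xy by simp
  then have "(x - y) ^ 2 ^ 2 ^ max i j = x - y" by (simp only: eq_diff_eq)
  then show "x - y \<in> F2_quad" unfolding F2_quad_def by blast
  have "(x / y) ^ 2 ^ 2 ^ max i j = x / y" using xy by (simp add: power_divide)
  then show "x / y \<in> F2_quad" unfolding F2_quad_def by blast
qed

lemma F2_quad_countable: "countable F2_quad"
proof -
  have "finite {x :: gf2 alg_closure. x ^ 2 ^ 2 ^ j = x}" for j
  proof -
    have "{x :: gf2 alg_closure. x ^ 2 ^ 2 ^ j = x} \<subseteq> insert 0 {x. x ^ quad_order j = 1}"
      using F2_quad_iff by blast
    moreover have "finite (insert 0 {x :: gf2 alg_closure. x ^ quad_order j = 1})"
      using finite_roots_of_unity[OF quad_order_pos] by simp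
    ultimately show ?thesis by (rule finite_subset)
  qed
  then have "countable (\<Union>j. {x :: gf2 alg_closure. x ^ 2 ^ 2 ^ j = x})"
    by (intro countable_UN) (auto intro: countable_finite)
  moreover have "F2_quad = (\<Union>j. {x. x ^ 2 ^ 2 ^ j = x})" by (auto simp: F2_quad_def)
  ultimately show ?thesis by simp
qed

lemma F2_quad_torsion: "x \<in> F2_quad \<Longrightarrow> x \<noteq> 0 \<Longrightarrow> \<exists>r>0. x ^ r = 1"
proof -
  assume "x \<in> F2_quad" "x \<noteq> 0"
  then obtain j where "x ^ quad_order j = 1" using F2_quad_iff by (auto simp: F2_quad_def)
  moreover have "quad_order j > 0" by (rule quad_order_pos)
  ultimately show ?thesis by blast
qed

text \<open>After level j + 1 only Fermat numbers coprime to p are multiplied in, so the p-primary part of the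
multiplicative group no longer grows.\<close>

lemma quad_order_prime_part_stable:
  assumes "prime p" "p dvd fermat j" "fermat j = p ^ v * r" "\<not> p dvd r" "j < i"
  shows "\<exists>s. quad_order i = p ^ v * s \<and> \<not> p dvd s"
proof -
  have "Suc j \<le> i" using assms(5) by simp
  then show ?thesis
  proof (induction i rule: dec_induct)
    case base
    have "quad_order (Suc j) = p ^ v * (quad_order j * r)"
      using assms(3) by (simp add: quad_order_Suc)
    moreover have "\<not> p dvd quad_order j * r"
      using assms fermat_prime_not_dvd_quad_order[of p j j] by (simp add: prime_dvd_mult_iff)
    ultimately show ?case by blast
  next
    case (step i)
    then obtain s where s: "quad_order i = p ^ v * s" "\<not> p dvd s" by blast
    have "p dvd quad_order (Suc j)" using assms(2) by (simp add: quad_order_Suc)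
    then have "p dvd quad_order i" using step(1) quad_order_dvd dvd_trans by blast
    then have "\<not> p dvd fermat i" using fermat_prime_not_dvd_quad_order[OF assms(1), of i i] by blast
    then have "\<not> p dvd s * fermat i" using s(2) assms(1) by (simp add: prime_dvd_mult_iff)
    moreover have "quad_order (Suc i) = p ^ v * (s * fermat i)" by (simp add: quad_order_Suc s)
    ultimately show ?case by blast
  qed
qed

text \<open>An element of the p-primary part of the multiplicative group that is not a p-th power inside that
finite group. A p-th root in a larger field of the union would lie in the same group, as its order is
a power of p and the p-primary part has stopped growing.\<close>

lemma F2_quad_non_power:
  assumes "prime p" "p dvd fermat j"
  shows "\<exists>\<zeta>\<in>F2_quad. (\<exists>v. \<zeta> ^ (p ^ v) = 1) \<and> (\<forall>y\<in>F2_quad. y ^ p \<noteq> \<zeta>)"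
proof -
  have char: "of_nat p \<noteq> (0 :: gf2 alg_closure)"
    by (rule fermat_prime_nonzero[OF assms])
  have p1: "p > 1" using assms(1) prime_gt_1_nat by simp
  have "fermat j \<noteq> 0" by (simp add: fermat_def)
  then obtain r where r: "fermat j = p ^ multiplicity p (fermat j) * r" "\<not> p dvd r"
    using multiplicity_decompose'[of "fermat j" p] p1 by auto
  define v where "v = multiplicity p (fermat j)"
  have v: "v > 0" using r assms(2) unfolding v_def by (cases "multiplicity p (fermat j)") auto
  obtain \<zeta> :: "gf2 alg_closure" where \<zeta>: "\<zeta> ^ (p ^ v) = 1" "\<And>y. y ^ (p ^ v) = 1 \<Longrightarrow> y ^ p \<noteq> \<zeta>"
    using non_power_of_prime_power_order[OF char p1 v] by blast
  have z0: "\<zeta> \<noteq> 0" using \<zeta>(1) p1 by (auto simp: power_0_left)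
  have "quad_order (Suc j) = p ^ v * (r * quad_order j)"
    using r(1) by (simp add: quad_order_Suc v_def)
  then have "\<zeta> ^ quad_order (Suc j) = 1" using \<zeta>(1) by (simp add: power_mult)
  then have "\<zeta> \<in> F2_quad" using F2_quad_iff[OF z0] unfolding F2_quad_def by blast
  moreover have "y ^ p \<noteq> \<zeta>" if y: "y \<in> F2_quad" for y
  proof
    assume yp: "y ^ p = \<zeta>"
    then have y0: "y \<noteq> 0" using z0 p1 by auto
    obtain i where "y ^ 2 ^ 2 ^ i = y" using y by (auto simp: F2_quad_def)
    then have "y ^ 2 ^ 2 ^ max i (Suc j) = y" using F2_quad_mono by auto
    then have 1: "y ^ quad_order (max i (Suc j)) = 1" using F2_quad_iff[OF y0] by blast
    obtain s where s: "quad_order (max i (Suc j)) = p ^ v * s" "\<not> p dvd s"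
      using quad_order_prime_part_stable[OF assms r[folded v_def]] by (metis less_max_iff_disj lessI)
    \<comment> \<open>The order of ?z divides both p and s, so y lies in the group of order p ^ v.\<close>
    let ?z = "y ^ (p ^ v)"
    have "?z ^ s = 1" using 1 by (simp add: s power_mult)
    moreover have "coprime p s" using s(2) assms(1) prime_imp_coprime by blast
    ultimately obtain n where "?z = (?z ^ n) ^ p" using coprime_order_imp_power p1 by (metis less_trans zero_less_one)
    moreover have "(?z ^ n) ^ p = ((y ^ p) ^ (p ^ v)) ^ n" by (simp add: mult_ac flip: power_mult)
    ultimately have "?z = 1" using yp \<zeta>(1) by simp
    then show False using \<zeta>(2) yp by blast
  qed
  ultimately show ?thesis using \<zeta>(1) by blast
qed

lemma torsion_field_exists:
  "\<exists>\<zeta> l. torsion_field F2_quad \<zeta> l"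
proof -
  have "\<exists>p. prime p \<and> p dvd fermat j" for j
    by (rule prime_factor_nat) (simp add: fermat_def)
  then obtain l where l: "\<And>j. prime (l j)" "\<And>j. l j dvd fermat j" by metis
  have "\<exists>\<zeta>. \<zeta> \<in> F2_quad \<and> (\<exists>v. \<zeta> ^ (l j ^ v) = 1) \<and> (\<forall>y\<in>F2_quad. y ^ l j \<noteq> \<zeta>)" for j
    using F2_quad_non_power[OF l] by blast
  then obtain \<zeta> where \<zeta>: "\<And>j. \<zeta> j \<in> F2_quad" "\<And>j. \<exists>v. \<zeta> j ^ (l j ^ v) = 1"
    "\<And>j y. y \<in> F2_quad \<Longrightarrow> y ^ l j \<noteq> \<zeta> j" by metis
  have neq: "l i \<noteq> l j" if "i < j" for i j
  proof -
    have "l i dvd quad_order (Suc i)" using l(2) by (simp add: quad_order_Suc)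
    then have "l i dvd quad_order j" using quad_order_dvd[of "Suc i" j] that dvd_trans by auto
    then show ?thesis using fermat_prime_not_dvd_quad_order[OF l, of j j] by auto
  qed
  have "inj l" using neq by (metis injI linorder_neqE_nat)
  moreover have "of_nat (l j) \<noteq> (0 :: gf2 alg_closure)" for j
    by (rule fermat_prime_nonzero[OF l])
  ultimately have "torsion_field F2_quad \<zeta> l"
    using F2_quad_subfield F2_quad_countable F2_quad_torsion l \<zeta> by unfold_locales auto
  then show ?thesis by blast
qed

section \<open>Existence of the tower\<close>

definition const_in :: "'c::field \<Rightarrow> 'c poly fract alg_closure" where
  "const_in a = to_ac (to_fract [:a:])"

lemma const_in_hom:
  "const_in 0 = 0" "const_in 1 = 1" "const_in (a + b) = const_in a + const_in b"
  "const_in (a * b) = const_in a * const_in b" "const_in (- a) = - const_in a"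
proof -
  have "[:a + b:] = [:a:] + [:b:]" "[:a * b:] = [:a:] * [:b:]" "[:- a:] = - [:a:]" by simp_all
  then show "const_in (a + b) = const_in a + const_in b"
    "const_in (a * b) = const_in a * const_in b" "const_in (- a) = - const_in a"
    unfolding const_in_def by (simp_all only: to_fract_add to_fract_mult to_fract_uminus to_ac_add to_ac_mult to_ac_minus)
qed (simp_all add: const_in_def flip: one_pCons)

lemma const_in_eq_0 [simp]: "const_in a = 0 \<longleftrightarrow> a = 0"
  by (simp add: const_in_def)

lemma const_in_power: "const_in (a ^ n) = const_in a ^ n"
  by (induction n) (simp_all add: const_in_hom)

definition eval_at :: "'c poly fract alg_closure \<Rightarrow> 'c::field poly \<Rightarrow> 'c poly fract alg_closure" where
  "eval_at x P = poly (map_poly const_in P) x"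

lemma eval_at_0 [simp]: "eval_at x 0 = 0"
  by (simp add: eval_at_def)

lemma eval_at_pCons [simp]: "eval_at x (pCons a P) = const_in a + x * eval_at x P"
  by (simp add: eval_at_def map_poly_pCons const_in_hom)

lemma eval_at_add: "eval_at x (P + Q) = eval_at x P + eval_at x Q"
  by (induction P Q rule: poly_induct2) (simp_all add: const_in_hom algebra_simps)

lemma eval_at_smult: "eval_at x (smult a P) = const_in a * eval_at x P"
  by (induction P) (simp_all add: const_in_hom algebra_simps)

lemma eval_at_mult: "eval_at x (P * Q) = eval_at x P * eval_at x Q"
  by (induction P) (simp_all add: eval_at_add eval_at_smult const_in_hom algebra_simps)

lemma eval_at_1: "eval_at x 1 = 1"
  by (simp add: one_pCons const_in_hom)

lemma eval_at_monom: "eval_at x (monom a n) = const_in a * x ^ n"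
  by (simp add: eval_at_def map_poly_monom const_in_hom poly_monom)

lemma eval_at_pcompose: "eval_at x (pcompose P Q) = eval_at (eval_at x Q) P"
  by (induction P) (simp_all add: pcompose_pCons eval_at_add eval_at_mult)

text \<open>Over algebraically closed constants, an element that is not itself a constant is transcendental,
as every polynomial splits into linear factors.\<close>

lemma eval_at_eq_0:
  fixes P :: "'c::alg_closed_field poly"
  assumes "x \<notin> range const_in" "eval_at x P = 0"
  shows "P = 0"
  using assms(2)
proof (induction "degree P" arbitrary: P)
  case 0
  then obtain a where "P = [:a:]" by (metis degree_eq_zeroE)
  then show ?case using 0 by simp
next
  case (Suc n)
  then obtain a where "poly P a = 0" using alg_closed_imp_poly_has_root[of P] by auto
  then obtain Q where Q: "P = [:- a, 1:] * Q" using poly_eq_0_iff_dvd by blast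
  have "eval_at x P = (x - const_in a) * eval_at x Q"
    unfolding Q eval_at_mult by (simp add: const_in_hom)
  then have "eval_at x Q = 0" using Suc.prems assms(1) by auto
  moreover have "n = degree Q"
  proof -
    have "Q \<noteq> 0" using Suc.hyps(2) Q by auto
    then show ?thesis using Suc.hyps(2) unfolding Q by (simp add: degree_mult_eq del: mult_pCons_left)
  qed
  ultimately have "Q = 0" using Suc.hyps(1) by blast
  then show ?case using Q by simp
qed

text \<open>The generators s_j are chosen one after the other as roots in an algebraic closure of the rational
function field. None of them is a constant, since a constant s_(j+1) would make s_j constant.\<close>

lemma radical_tower_exists:
  assumes "torsion_field k \<zeta> l"
  shows "\<exists>e :: nat \<Rightarrow> 'c poly \<Rightarrow> 'c::alg_closed_field poly fract alg_closure. radical_tower k \<zeta> l e"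
proof -
  interpret torsion_field k \<zeta> l by fact
  define s :: "nat \<Rightarrow> 'c poly fract alg_closure" where
    "s = rec_nat (to_ac (to_fract [:0, 1:])) (\<lambda>j y. SOME z. z ^ l j = y / const_in (\<zeta> j))"
  have s_Suc: "s j = const_in (\<zeta> j) * s (Suc j) ^ l j" for j
  proof -
    have "s (Suc j) ^ l j = s j / const_in (\<zeta> j)"
      unfolding s_def by simp (rule someI_ex, rule nth_root_exists, rule l_gt_0)
    then show ?thesis using \<zeta>_nz by simp
  qed
  have s_trans: "s j \<notin> range const_in" for j
  proof (induction j)
    case 0
    show ?case by (auto simp: s_def const_in_def)
  next
    case (Suc j)
    show ?case
    proof
      assume "s (Suc j) \<in> range const_in"
      then obtain a where "s (Suc j) = const_in a" by blast
      then have "s j = const_in (\<zeta> j * a ^ l j)"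
        using s_Suc[of j] by (simp add: const_in_hom const_in_power)
      then show False using Suc by blast
    qed
  qed
  have "radical_tower k \<zeta> l (\<lambda>j. eval_at (s j))"
  proof unfold_locales
    show "eval_at (s J) P = eval_at (s (Suc J)) (pcompose P (monom (\<zeta> J) (l J)))" for J P
      by (simp add: eval_at_pcompose eval_at_monom flip: s_Suc)
  qed (simp_all add: eval_at_add eval_at_mult eval_at_1 eval_at_eq_0[OF s_trans])
  then show ?thesis by blast
qed

section \<open>Transport to the complex numbers as carrier type\<close>

lemma transport_countable_field:
  fixes K :: "'a::field set"
  assumes K: "is_subfield K" and "countable K"
  obtains R :: "complex ring" and \<phi> where "field R" "inj_on \<phi> K" "carrier R = \<phi> ` K"
    "\<zero>\<^bsub>R\<^esub> = \<phi> 0" "\<one>\<^bsub>R\<^esub> = \<phi> 1" "\<And>x y. x \<in> K \<Longrightarrow> y \<in> K \<Longrightarrow> \<phi> x \<otimes>\<^bsub>R\<^esub> \<phi> y = \<phi> (x * y)"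
proof -
  define R0 :: "'a ring" where
    "R0 = \<lparr>carrier = K, monoid.mult = (*), one = 1, ring.zero = 0, add = (+)\<rparr>"
  note KD = is_subfieldD[OF K]
  have "cring R0"
  proof (rule cringI)
    show "abelian_group R0"
      unfolding R0_def
      by (rule abelian_groupI) (auto simp: KD intro!: bexI[of _ "- x" for x])
    show "comm_monoid R0"
      unfolding R0_def by (rule comm_monoidI) (auto simp: KD)
  qed (auto simp: R0_def algebra_simps)
  then interpret R0: cring R0 .
  have "field R0"
  proof (rule R0.cring_fieldI2)
    fix x assume "x \<in> carrier R0" "x \<noteq> \<zero>\<^bsub>R0\<^esub>"
    then show "\<exists>y\<in>carrier R0. x \<otimes>\<^bsub>R0\<^esub> y = \<one>\<^bsub>R0\<^esub>"
      by (auto simp: R0_def KD intro!: bexI[of _ "inverse x"])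
  qed (simp add: R0_def)
  then interpret R0: field R0 .
  define \<phi> :: "'a \<Rightarrow> complex" where "\<phi> x = of_nat (to_nat_on K x)" for x
  have inj: "inj_on \<phi> (carrier R0)"
    using inj_on_to_nat_on[OF assms(2)] by (auto simp: \<phi>_def R0_def inj_on_def)
  have hom: "\<phi> \<in> ring_hom R0 (image_ring \<phi> R0)"
    using inj_imp_image_ring_iso[OF inj] by (simp add: ring_iso_def)
  show ?thesis
  proof (rule that[of "image_ring \<phi> R0" \<phi>])
    show "field (image_ring \<phi> R0)" using R0.inj_imp_image_ring_is_field[OF inj] .
    show "\<phi> x \<otimes>\<^bsub>image_ring \<phi> R0\<^esub> \<phi> y = \<phi> (x * y)" if "x \<in> K" "y \<in> K" for x y
      using ring_hom_mult[OF hom, of x y] that by (simp add: R0_def)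
  qed (use inj in \<open>simp_all add: image_ring_carrier image_ring_zero image_ring_one R0_def\<close>)
qed

theorem mainTheorem11:
  "\<exists>K :: complex ring. field K \<and> rootless K \<and> \<not> rootless_modtor K"
proof -
  obtain \<zeta> l where "torsion_field F2_quad \<zeta> l" using torsion_field_exists by blast
  then obtain e :: "nat \<Rightarrow> gf2 alg_closure poly \<Rightarrow> gf2 alg_closure poly fract alg_closure"
    where "radical_tower F2_quad \<zeta> l e" using radical_tower_exists by blast
  then interpret radical_tower F2_quad \<zeta> l e .
  obtain R :: "complex ring" and \<phi> where R: "field R" "inj_on \<phi> tower_field" "carrier R = \<phi> ` tower_field"
    "\<zero>\<^bsub>R\<^esub> = \<phi> 0" "\<one>\<^bsub>R\<^esub> = \<phi> 1"
    and mult: "\<And>x y. x \<in> tower_field \<Longrightarrow> y \<in> tower_field \<Longrightarrow> \<phi> x \<otimes>\<^bsub>R\<^esub> \<phi> y = \<phi> (x * y)"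
    using transport_countable_field[OF tower_field_subfield tower_field_countable] by blast
  interpret R: field R by fact
  have inj: "\<phi> x = \<phi> y \<longleftrightarrow> x = y" if "x \<in> tower_field" "y \<in> tower_field" for x y
    using R(2) that by (auto simp: inj_on_def)
  note KD = is_subfieldD[OF tower_field_subfield]
  have power: "\<phi> x [^]\<^bsub>R\<^esub> n = \<phi> (x ^ n)" if "x \<in> tower_field" for x and n :: nat
    by (induction n) (simp_all add: R(5) mult that is_subfield_power[OF tower_field_subfield] mult.commute)
  have root_of_unity: "is_root_of_unity R (\<phi> x) \<longleftrightarrow> (\<exists>n\<ge>1. x ^ n = 1)" if "x \<in> tower_field" for x
    using that by (simp add: is_root_of_unity_def R(3,5) power inj is_subfield_power[OF tower_field_subfield] KD)
  have roots: "(\<exists>z\<in>carrier R. z [^]\<^bsub>R\<^esub> n = \<phi> x) \<longleftrightarrow> (\<exists>y\<in>tower_field. y ^ n = x)" if "x \<in> tower_field" for x and n :: nat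
    using that by (simp add: R(3) power inj is_subfield_power[OF tower_field_subfield])
  have "rootless R"
    unfolding rootless_def
  proof (intro ballI impI)
    fix f assume f: "f \<in> carrier R" "f \<noteq> \<zero>\<^bsub>R\<^esub> \<and> \<not> is_root_of_unity R f"
    then obtain x where x: "x \<in> tower_field" "f = \<phi> x" using R(3) by auto
    have "x \<noteq> 0" using f x R(4) by auto
    moreover have "x ^ n \<noteq> 1" if "n \<ge> 1" for n using f x root_of_unity that by blast
    ultimately have "finite {n. n \<ge> 1 \<and> (\<exists>y\<in>tower_field. y ^ n = x)}" by (rule tower_field_finite_roots[OF x(1)])
    then show "rootless_elem R f"
      using f unfolding rootless_elem_def x(2) roots[OF x(1)] by blast
  qed
  moreover have "\<not> rootless_modtor R"
  proof
    assume modtor: "rootless_modtor R"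
    define x where "x = e 0 [:0, 1:]"
    note x = tower_field_infinite_twisted_roots[folded x_def]
    have "\<phi> x \<in> carrier R" "\<phi> x \<noteq> \<zero>\<^bsub>R\<^esub>" "\<not> is_root_of_unity R (\<phi> x)"
      using x(1-3) by (auto simp: R(3,4) inj KD root_of_unity)
    then have "rootless_modtor_elem R (\<phi> x)" using modtor by (simp add: rootless_modtor_def)
    then have fin: "finite {n::nat. n \<ge> 1 \<and> \<not> (\<forall>\<zeta>. is_root_of_unity R \<zeta> \<longrightarrow>
      \<not> (\<exists>y \<in> carrier R. y [^]\<^bsub>R\<^esub> n = \<zeta> \<otimes>\<^bsub>R\<^esub> \<phi> x))}"
      by (simp add: rootless_modtor_elem_def)
    have "finite {n. n \<ge> 1 \<and> (\<exists>\<omega>\<in>tower_field. (\<exists>r\<ge>1. \<omega> ^ r = 1) \<and> (\<exists>y\<in>tower_field. y ^ n = \<omega> * x))}"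
    proof (rule finite_subset[OF _ fin], safe)
      fix n r :: nat and \<omega> y
      assume *: "\<forall>\<zeta>. is_root_of_unity R \<zeta> \<longrightarrow> \<not> (\<exists>y \<in> carrier R. y [^]\<^bsub>R\<^esub> n = \<zeta> \<otimes>\<^bsub>R\<^esub> \<phi> x)"
        and "\<omega> \<in> tower_field" "r \<ge> 1" "\<omega> ^ r = 1" "y \<in> tower_field" "y ^ n = \<omega> * x"
      then have "is_root_of_unity R (\<phi> \<omega>)" "\<phi> y \<in> carrier R" "\<phi> y [^]\<^bsub>R\<^esub> n = \<phi> \<omega> \<otimes>\<^bsub>R\<^esub> \<phi> x"
        using x(1) by (auto simp: root_of_unity R(3) power mult)
      then show False using * by blast
    qed
    then show False using x(4) by blast
  qed
  ultimately show ?thesis using R(1) by blast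
qed

end
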